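(* Let $b$ be a graph over $(X,m)$. For any $p\in[1,\infty)$ and any function $d:X\times X\to[0,\infty)$ with $\delta(d)>0$, we have $$\lambda^{(0)}_{p}\leq\frac{h^{(0)}(d)}{\delta(d)}.$$
   Context: Setting: $X$ is a nonempty countable (finite or infinite) set, $C(X)$ is the space of real-valued functions on $X$ and $C_c(X)$ the subspace of finitely supported functions. A graph $b$ over $(X,m)$ consists of a symmetric function $b:X\times X\to[0,\infty)$ with $b(x,x)=0$ and $\sum_{y\in X}b(x,y)<\infty$ for all $x\in X$, and a function $m:X\to(0,\infty)$, extended to a measure on subsets by $m(W)=\sum_{x\in W}m(x)$. $\|f\|_{m,p}=\bigl(\sum_{x\in X}|f(x)|^p m(x)\bigr)^{1/p}$. Energy: $\mathcal{E}_p(f)=\frac12\sum_{x,y\in X}b(x,y)|f(x)-f(y)|^p\in[0,\infty]$ for $f\in C(X)$, and $$\lambda^{(0)}_p=\inf_{0\neq\varphi\in C_c(X)}\frac{\mathcal{E}_p(\varphi)}{\|\varphi\|_{m,p}^p}.$$ For $W\subseteq X$, $\partial W=W\times(X\setminus W)$, and for $d:X\times X\to[0,\infty)$, $|\partial W|_{bd}=\sum_{(x,y)\in\partial W}b(x,y)d(x,y)\in[0,\infty]$, $$h^{(0)}(d)=\inf_{\emptyset\ne W\subseteq X\text{ finite}}\frac{|\partial W|_{bd}}{m(W)},\qquad \delta(d)=\inf\{d(x,y): x,y\in X,\ b(x,y)>0\}.$$ Conventions: $\inf\emptyset=+\infty$ and $a/(+\infty)=0$ for $a\in[0,\infty)$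 (relevant only if $b\equiv0$). *)

theory Defs
  imports "HOL-Analysis.Analysis"
begin

text \<open>
  The vertex set is the universe of a type of class \<^class>\<open>countable\<close>. Quantities with
  values in \<open>[0, \<infinity>]\<close> have type \<^typ>\<open>ennreal\<close>, where the infimum of the empty set is \<open>\<infinity>\<close>,
  \<open>a / \<infinity> = 0\<close>, and every family is summable for \<^const>\<open>infsum\<close>.
\<close>

definition graph_over :: "('a::countable \<Rightarrow> 'a \<Rightarrow> real) \<Rightarrow> ('a \<Rightarrow> real) \<Rightarrow> bool" where
  "graph_over b m \<longleftrightarrow>
     (\<forall>x y. 0 \<le> b x y) \<and>
     (\<forall>x y. b x y = b y x) \<and>
     (\<forall>x. b x x = 0) \<and>
     (\<forall>x. (\<lambda>y. b x y) summable_on UNIV) \<and>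
     (\<forall>x. 0 < m x)"

definition weight :: "('a \<Rightarrow> real) \<Rightarrow> 'a set \<Rightarrow> ennreal" where
  "weight m W = (\<Sum>\<^sub>\<infinity>x\<in>W. ennreal (m x))"

definition Cc :: "('a \<Rightarrow> real) set" where
  "Cc = {f. finite {x. f x \<noteq> 0}}"

text \<open>
  Real-valued, hence meaningful only if the sum converges; it is applied to finitely
  supported functions only.
\<close>
definition lp_norm :: "('a \<Rightarrow> real) \<Rightarrow> real \<Rightarrow> ('a \<Rightarrow> real) \<Rightarrow> real" where
  "lp_norm m p f = (\<Sum>\<^sub>\<infinity>x. \<bar>f x\<bar> powr p * m x) powr (1 / p)"

definition energy :: "('a \<Rightarrow> 'a \<Rightarrow> real) \<Rightarrow> real \<Rightarrow> ('a \<Rightarrow> real) \<Rightarrow> ennreal" where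
  "energy b p f = (1 / 2) * (\<Sum>\<^sub>\<infinity>(x, y). ennreal (b x y * \<bar>f x - f y\<bar> powr p))"

definition lambda0 :: "('a \<Rightarrow> 'a \<Rightarrow> real) \<Rightarrow> ('a \<Rightarrow> real) \<Rightarrow> real \<Rightarrow> ennreal" where
  "lambda0 b m p =
     (INF \<phi> \<in> {\<phi> \<in> Cc. \<phi> \<noteq> (\<lambda>_. 0)}. energy b p \<phi> / ennreal (lp_norm m p \<phi> powr p))"

definition edge_boundary :: "'a set \<Rightarrow> ('a \<times> 'a) set" where
  "edge_boundary W = W \<times> (UNIV - W)"

definition boundary_size ::
    "('a \<Rightarrow> 'a \<Rightarrow> real) \<Rightarrow> ('a \<Rightarrow> 'a \<Rightarrow> real) \<Rightarrow> 'a set \<Rightarrow> ennreal" where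
  "boundary_size b d W = (\<Sum>\<^sub>\<infinity>(x, y)\<in>edge_boundary W. ennreal (b x y * d x y))"

definition cheeger0 ::
    "('a \<Rightarrow> 'a \<Rightarrow> real) \<Rightarrow> ('a \<Rightarrow> real) \<Rightarrow> ('a \<Rightarrow> 'a \<Rightarrow> real) \<Rightarrow> ennreal" where
  "cheeger0 b m d = (INF W \<in> {W. W \<noteq> {} \<and> finite W}. boundary_size b d W / weight m W)"

definition delta :: "('a \<Rightarrow> 'a \<Rightarrow> real) \<Rightarrow> ('a \<Rightarrow> 'a \<Rightarrow> real) \<Rightarrow> ennreal" where
  "delta b d = (INF (x, y) \<in> {(x, y). b x y > 0}. ennreal (d x y))"

end

theory Submission
  imports Defs
begin

text \<open>
  Test \<open>\<lambda>\<^sub>p\<close> on the indicator function of a finite set \<open>W\<close>. Differences of its values are \<open>0\<close> or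
  \<open>\<plusminus>1\<close>, so its energy is the \<open>b\<close>-mass of the boundary for every \<open>p\<close>, and there \<open>b\<close> is at most
  \<open>b d / \<delta>(d)\<close>.
\<close>

text \<open>An infinite sum in \<open>ennreal\<close> is the supremum of the finite partial sums,
  and multiplication commutes with suprema. This covers \<open>c = top\<close>.\<close>

lemma infsum_cmult_ennreal:
  fixes f :: "'a \<Rightarrow> ennreal"
  shows "(\<Sum>\<^sub>\<infinity>x\<in>A. c * f x) = c * (\<Sum>\<^sub>\<infinity>x\<in>A. f x)"
  by (simp add: nonneg_infsum_complete SUP_mult_left_ennreal sum_distrib_left)

lemma energy_indicator:
  assumes "\<And>x y. b x y = b y x"
  shows "energy b p (indicator W) = (\<Sum>\<^sub>\<infinity>(x, y)\<in>edge_boundary W. ennreal (b x y))"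
proof -
  let ?B = "edge_boundary W" and ?f = "\<lambda>(x, y). ennreal (b x y)"
  \<comment> \<open>The two indicator values differ exactly on the boundary and its mirror image.
    All other pairs vanish because \<open>0 powr p = 0\<close> for every real
    \<open>p\<close>.\<close>
  have "(\<Sum>\<^sub>\<infinity>(x, y). ennreal (b x y * \<bar>indicator W x - indicator W y\<bar> powr p))
      = infsum ?f (?B \<union> prod.swap ` ?B)"
    by (rule infsum_cong_neutral) (auto simp: edge_boundary_def product_swap indicator_def of_bool_def split: if_splits)
  also have "\<dots> = infsum ?f ?B + infsum ?f (prod.swap ` ?B)"
    by (intro infsum_Un_disjoint nonneg_summable_on_complete) (auto simp: edge_boundary_def)
  \<comment> \<open>Symmetry of \<open>b\<close> makes both halves equal, which cancels the factor
    1/2 in the energy.\<close>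
  also have "infsum ?f (prod.swap ` ?B) = infsum ?f ?B"
    by (subst infsum_reindex) (auto simp: assms intro!: infsum_cong)
  finally have "energy b p (indicator W) = 1 / 2 * (2 * infsum ?f ?B)"
    by (simp add: energy_def mult_2)
  also have "\<dots> = infsum ?f ?B"
    by (simp add: mult.assoc[symmetric] ennreal_divide_times)
  finally show ?thesis .
qed

lemma delta_mult_energy_indicator_le:
  assumes "\<And>x y. 0 \<le> b x y" and "\<And>x y. b x y = b y x"
  shows "delta b d * energy b p (indicator W) \<le> boundary_size b d W"
proof -
  have "delta b d * ennreal (b x y) \<le> ennreal (b x y * d x y)" for x y
  proof (cases "b x y > 0")
    case True
    then have "delta b d \<le> ennreal (d x y)"
      unfolding delta_def by (intro INF_lower2[of "(x, y)"]) auto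
    then show ?thesis
      using assms(1)[of x y] by (simp add: ennreal_mult' mult.commute[of "delta b d"] mult_left_mono)
  \<comment> \<open>Off the edges \<open>d\<close> may lie below \<open>delta b d\<close>, but there
    \<open>b x y = 0\<close>, and \<open>top * 0 = 0\<close> handles an infinite
    \<open>delta b d\<close>.\<close>
  qed (use assms(1)[of x y] in simp)
  then show ?thesis
    unfolding energy_indicator[of b, OF assms(2)] boundary_size_def infsum_cmult_ennreal[symmetric]
    by (intro infsum_mono nonneg_summable_on_complete) auto
qed

lemma lp_norm_indicator_powr:
  assumes "finite W" and "\<And>x. 0 \<le> m x" and "p \<noteq> 0"
  shows "ennreal (lp_norm m p (indicator W) powr p) = weight m W"
proof -
  have "(\<Sum>\<^sub>\<infinity>x. \<bar>indicator W x\<bar> powr p * m x) = (\<Sum>\<^sub>\<infinity>x\<in>W. m x)"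
    by (rule infsum_cong_neutral) auto
  then show ?thesis
    using assms by (simp add: lp_norm_def weight_def powr_powr sum_nonneg)
qed

lemma lambda0_le_energy_indicator:
  assumes "finite W" and "W \<noteq> {}" and "\<And>x. 0 \<le> m x" and "p \<noteq> 0"
  shows "lambda0 b m p \<le> energy b p (indicator W) / weight m W"
  unfolding lp_norm_indicator_powr[OF assms(1,3,4), symmetric] lambda0_def
  using assms(1,2)
  by (intro INF_lower) (auto simp: Cc_def indicator_def fun_eq_iff)

theorem theorem3p9:
  fixes b d :: "'a::countable \<Rightarrow> 'a \<Rightarrow> real" and m :: "'a \<Rightarrow> real" and p :: real
  assumes "graph_over b m"
    and "1 \<le> p"
    and "\<And>x y. 0 \<le> d x y"
    and "0 < delta b d"
  shows "lambda0 b m p \<le> cheeger0 b m d / delta b d"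
proof -
  have b: "0 \<le> b x y" "b x y = b y x" and m: "0 \<le> m x" for x y
    using assms(1) by (auto simp: graph_over_def less_imp_le)
  have p: "p \<noteq> 0"
    using assms(2) by simp
  show ?thesis
  proof (cases "delta b d = top")
    \<comment> \<open>An infinite \<open>delta b d\<close> means that there are no edges. The
      right-hand side is then 0, so some test function must have zero energy; the indicator of any
      vertex will do, and \<open>undefined\<close> names one.\<close>
    case True
    have "b x y = 0" for x y
    proof (rule ccontr)
      assume "b x y \<noteq> 0"
      then have "delta b d \<le> ennreal (d x y)"
        using b(1)[of x y] unfolding delta_def by (intro INF_lower2[of "(x, y)"]) auto
      with True show False
        by (simp add: top_unique)
    qed
    then have "energy b p (indicator {undefined}) = 0"
      by (simp add: energy_def case_prod_unfold)
    then show ?thesis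
      using lambda0_le_energy_indicator[of "{undefined}" m p b] m p by simp
  next
    case False
    \<comment> \<open>In product form the bound can be checked for each \<open>W\<close>
      separately.\<close>
    have "delta b d * lambda0 b m p \<le> cheeger0 b m d"
      unfolding cheeger0_def
    proof (rule INF_greatest, clarify)
      fix W :: "'a set"
      assume W: "W \<noteq> {}" "finite W"
      have "delta b d * lambda0 b m p \<le> delta b d * (energy b p (indicator W) / weight m W)"
        by (intro mult_left_mono lambda0_le_energy_indicator W m p) simp
      also have "\<dots> \<le> boundary_size b d W / weight m W"
        using delta_mult_energy_indicator_le[of b d p W] b
        by (simp add: ennreal_times_divide divide_right_mono_ennreal)
      finally show "delta b d * lambda0 b m p \<le> boundary_size b d W / weight m W" .
    qed
    then have "delta b d * lambda0 b m p / delta b d \<le> cheeger0 b m d / delta b d"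
      by (rule divide_right_mono_ennreal)
    \<comment> \<open>Cancelling \<open>delta b d\<close> is legitimate in \<open>ennreal\<close>
      because it is neither 0 nor \<open>top\<close>.\<close>
    then show ?thesis
      using False assms(4) by (simp add: mult.commute[of "delta b d"] ennreal_mult_divide_eq)
  qed
qed

end
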